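(* Let $M$ be the recursively defined set of primes given in the context. Let $n$ be a counterexample to Carmichael's conjecture, that is, a positive integer such that $\varphi(m) \neq \varphi(n)$ for every positive integer $m \neq n$, and let $n$ be a multiple of $2^{42} \cdot 3^{47}$. Then for every finite set $\{p_1, \dots, p_s\}$ of distinct elements of $M \setminus \{2, 3\}$, the integer $n$ is a multiple of $$2^{42} \cdot 3^{47} \cdot p_1^2 \cdot p_2^2 \cdots p_s^2 .$$
   Context: $\varphi$ denotes Euler's totient function. The set $M$ is the smallest set of prime numbers such that: (a) $2, 3 \in M$; (b) if $r \geq 0$, $q_1, \dots, q_r$ are elements of $M$ such that $2, 3, q_1, \dots, q_r$ are pairwise distinct, $a \in \{0, 1, \dots, 41\}$, $b \in \{0, 1, \dots, 46\}$, and $p = 1 + 2^a \cdot 3^b \cdot q_1 \cdots q_r$ is prime, then $p \in M$. (That is, every element of $M$ is obtained by applying rules (a) and (b) a finite number of times.) *)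

theory Defs
  imports "HOL-Number_Theory.Number_Theory"
begin

inductive_set M :: "nat set" where
  two: "2 \<in> M"
| three: "3 \<in> M"
| step: "\<lbrakk> \<And>q. q \<in> set qs \<Longrightarrow> q \<in> M; distinct (2 # 3 # qs); a \<in> {0..41}; b \<in> {0..46};
           p = 1 + 2 ^ a * 3 ^ b * prod_list qs; prime p \<rbrakk> \<Longrightarrow> p \<in> M"

definition carmichael_counterexample :: "nat \<Rightarrow> bool" where
  "carmichael_counterexample n \<longleftrightarrow>
     n > 0 \<and> (\<forall>m. m > 0 \<and> m \<noteq> n \<longrightarrow> totient m \<noteq> totient n)"

end

theory Submission
  imports Defs
begin

(* For p prime, trading the factor p - 1 of n for p, or a simple factor p of n for p - 1,
   leaves the totient unchanged as long as the primes dividing p - 1 also divide the remaining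
   cofactor. A Carmichael counterexample n therefore cannot be coprime to p, nor divisible by p
   only once, and membership in M is inherited by induction on its generation. *)

text \<open>By the Euler product, \<open>totient m / m\<close> depends only on the set of primes
  dividing \<open>m\<close>, and \<open>d * k\<close> has the same primes as
  \<open>k\<close>.\<close>

lemma totient_mult_absorb:
  fixes d k :: nat
  assumes "\<And>r. prime r \<Longrightarrow> r dvd d \<Longrightarrow> r dvd k" and "d > 0"
  shows "totient (d * k) = d * totient k"
proof (cases "k = 0")
  case False
  have "prime_factors (d * k) = prime_factors k"
    using assms False by (auto simp: prime_factors_dvd prime_dvd_mult_iff)
  then have "real (totient (d * k)) = real (d * totient k)"
    by (simp add: totient_formula2)
  then show ?thesis
    by (simp only: of_nat_eq_iff)
qed simp

text \<open>Assumption \<open>r\<close> encodes that every prime factor of \<open>p - 1\<close>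
  still divides the cofactor \<open>n / (p - 1)\<close>.\<close>

lemma carmichael_counterexample_square_dvd:
  assumes n: "carmichael_counterexample n" and p: "prime p" and d: "(p - 1) dvd n"
    and r: "\<And>r. prime r \<Longrightarrow> r dvd p - 1 \<Longrightarrow> r * (p - 1) dvd n"
  shows "p\<^sup>2 dvd n"
proof -
  have n0: "n > 0" and uniq: "\<And>m. m > 0 \<Longrightarrow> totient m = totient n \<Longrightarrow> m = n"
    using n by (auto simp: carmichael_counterexample_def)
  have p1: "p > 1" "p - 1 > 0" using prime_gt_1_nat[OF p] by auto
  have "p dvd n"
  proof (rule ccontr)
    assume np: "\<not> p dvd n"
    obtain k where k: "n = (p - 1) * k" using d by (elim dvdE)
    have "r dvd k" if "prime r" "r dvd p - 1" for r
      using r[OF that] p1 by (auto simp: k mult.commute[of r])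
    then have "totient n = (p - 1) * totient k"
      unfolding k using p1 by (intro totient_mult_absorb)
    moreover have "coprime p k"
      using np p by (intro prime_imp_coprime) (auto simp: k)
    \<comment> \<open>The competitor to \<open>n\<close> is \<open>p * k\<close>: the new prime
      contributes \<open>totient p = p - 1\<close>, the very factor absorbed in
      \<open>n\<close>.\<close>
    ultimately have "totient (p * k) = totient n"
      by (simp add: totient_mult_coprime totient_prime p)
    then have "p * k = n" using n0 p1 by (intro uniq) (auto simp: k)
    with np show False by auto
  qed
  then obtain k where k: "n = p * k" by (elim dvdE)
  have "p dvd k"
  proof (rule ccontr)
    assume "\<not> p dvd k"
    then have "totient n = (p - 1) * totient k"
      by (simp add: k totient_mult_coprime totient_prime p prime_imp_coprime)
    \<comment> \<open>Now \<open>k\<close> is \<open>n / p\<close>. Since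
      \<open>r \<le> p - 1 < p\<close>, cancelling \<open>p\<close> from \<open>n\<close> cannot
      remove \<open>r\<close>.\<close>
    moreover have "r dvd k" if rr: "prime r" "r dvd p - 1" for r
    proof -
      have "r dvd n" using r[OF rr] by (metis dvd_mult_left)
      moreover have "r \<noteq> p" using dvd_imp_le[OF rr(2)] p1 by auto
      ultimately show ?thesis
        using rr(1) p by (auto simp: k prime_dvd_mult_iff primes_dvd_imp_eq)
    qed
    then have "totient ((p - 1) * k) = (p - 1) * totient k"
      using p1 by (intro totient_mult_absorb)
    ultimately have "(p - 1) * k = n"
      using n0 p1 by (intro uniq) (auto simp: k)
    then show False using n0 p1 by (auto simp: k)
  qed
  then show ?thesis by (simp add: k power2_eq_square)
qed

lemma prime_M: "p \<in> M \<Longrightarrow> prime p"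
  by (induction rule: M.induct) auto

text \<open>Powers of distinct primes are coprime, so separate divisibilities combine into one for
  their product.\<close>

lemma coprime_pow2_pow3_prod_squares_dvd:
  fixes n :: nat
  assumes "finite P" "\<And>p. p \<in> P \<Longrightarrow> prime p" "2 \<notin> P" "3 \<notin> P"
    and "\<And>p. p \<in> P \<Longrightarrow> p\<^sup>2 dvd n" "2 ^ u * 3 ^ v dvd n"
  shows "2 ^ u * 3 ^ v * (\<Prod>p\<in>P. p\<^sup>2) dvd n"
  using assms
proof (induction P rule: finite_induct)
  case (insert x P)
  have x: "prime x" "x \<noteq> 2" "x \<noteq> 3" using insert.prems by auto
  have "coprime x q" if "q \<in> P" for q
    using that insert by (intro primes_coprime) auto
  then have "coprime x (\<Prod>p\<in>P. p\<^sup>2)" by (intro prod_coprime_right) auto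
  moreover have "coprime x 2" "coprime x 3"
    using x by (auto intro: primes_coprime simp del: coprime_right_2_iff_odd)
  ultimately have "coprime (x\<^sup>2) (2 ^ u * 3 ^ v * (\<Prod>p\<in>P. p\<^sup>2))" by simp
  moreover have "2 ^ u * 3 ^ v * (\<Prod>p\<in>P. p\<^sup>2) dvd n" "x\<^sup>2 dvd n" using insert by auto
  ultimately have "x\<^sup>2 * (2 ^ u * 3 ^ v * (\<Prod>p\<in>P. p\<^sup>2)) dvd n"
    by (metis divides_mult)
  then show ?case using insert.hyps by (simp add: ac_simps)
qed simp

lemma M_square_dvd_carmichael_counterexample:
  assumes n: "carmichael_counterexample n" and dvd: "2 ^ 42 * 3 ^ 47 dvd n"
    and "p \<in> M" "p \<noteq> 2" "p \<noteq> 3"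
  shows "p\<^sup>2 dvd n"
  using assms(3-)
proof (induction rule: M.induct)
  case (step qs a b p)
  define Q where "Q = prod_list qs"
  have Q: "Q = \<Prod>(set qs)"
    using step.hyps by (simp add: Q_def prod.distinct_set_conv_list)
  \<comment> \<open>Distinctness of \<open>2 # 3 # qs\<close> keeps 2 and 3 out of
    \<open>qs\<close>, so the induction hypothesis applies to each \<open>q\<close>.\<close>
  have q: "prime q" "q\<^sup>2 dvd n" if "q \<in> set qs" for q
    using that step by (auto intro: prime_M)
  have "2 ^ 42 * 3 ^ 47 * (\<Prod>q\<in>set qs. q\<^sup>2) dvd n"
    using step.hyps q dvd by (intro coprime_pow2_pow3_prod_squares_dvd) auto
  then have "2 ^ 42 * 3 ^ 47 * Q\<^sup>2 dvd n"
    by (simp add: Q prod_power_distrib)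
  \<comment> \<open>The bounds \<open>a \<le> 41\<close> and \<open>b \<le> 46\<close> leave one
    spare factor 2 and one spare factor 3.\<close>
  moreover have "2 ^ Suc a * 3 ^ Suc b * Q\<^sup>2 dvd 2 ^ 42 * 3 ^ 47 * Q\<^sup>2"
    using step.hyps by (intro mult_dvd_mono le_imp_power_dvd) auto
  ultimately have "2 ^ Suc a * 3 ^ Suc b * Q\<^sup>2 dvd n"
    using dvd_trans by blast
  moreover have p1: "p - 1 = 2 ^ a * 3 ^ b * Q"
    using step.hyps by (simp add: Q_def)
  \<comment> \<open>Splitting off \<open>p - 1\<close> leaves \<open>2 * 3 * Q\<close>, which
    contains every possible prime factor of \<open>p - 1\<close>; the squares supply the second
    \<open>Q\<close>.\<close>
  ultimately have *: "2 * 3 * Q * (p - 1) dvd n"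
    by (simp add: power2_eq_square ac_simps)
  have "r * (p - 1) dvd n" if "prime r" "r dvd p - 1" for r
  proof -
    have "r dvd 2 \<or> r dvd 3 \<or> r dvd Q"
      using that unfolding p1 by (auto simp: prime_dvd_mult_iff dest: prime_dvd_power)
    then have "r dvd 2 * 3 * Q" by (meson dvd_mult dvd_mult2)
    then show ?thesis
      using * by (meson dvd_refl dvd_trans mult_dvd_mono)
  qed
  moreover have "p - 1 dvd n" using * by (rule dvd_mult_right)
  ultimately show ?case
    using n step.hyps by (intro carmichael_counterexample_square_dvd)
qed auto

theorem mainTheorem4:
  fixes n :: nat and P :: "nat set"
  assumes "carmichael_counterexample n"
    and "2 ^ 42 * 3 ^ 47 dvd n"
    and "finite P" and "P \<subseteq> M - {2, 3}"
  shows "2 ^ 42 * 3 ^ 47 * (\<Prod>p\<in>P. p ^ 2) dvd n"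
proof (rule coprime_pow2_pow3_prod_squares_dvd)
  show "prime p" "p\<^sup>2 dvd n" if "p \<in> P" for p
    using assms that by (auto intro: prime_M M_square_dvd_carmichael_counterexample)
qed (use assms in auto)

end
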